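(* There exists an infinite, bounded, uniformly discrete, complete metric space $M$ such that $c_0$ is not isometrically contained in $\operatorname{SNA}(M)$ and such that no point of $M$ attains its separation radius.
   Context: All vector spaces are real. Let $(M,d)$ be a pointed metric space, i.e. a metric space with a distinguished point $0\in M$ (its choice is irrelevant, since $f\mapsto f-f(0)$ is a linear isometry between the corresponding spaces preserving strong norm attainment). $\operatorname{Lip}_0(M)$ is the Banach space of all Lipschitz functions $f:M\to\mathbb{R}$ with $f(0)=0$, with norm $\|f\|_{\operatorname{Lip}}=\sup\{|f(y)-f(x)|/d(x,y): x,y\in M,\ x\ne y\}$. A function $f\in\operatorname{Lip}_0(M)$ strongly attains its norm if there are distinct $p,q\in M$ with $\|f\|_{\operatorname{Lip}}=|f(p)-f(q)|/d(p,q)$. $\operatorname{SNA}(M)\subseteq\operatorname{Lip}_0(M)$ is the set of all functions that strongly attain their norm. A Banach space $Y$ is isometrically contained in $\operatorname{SNA}(M)$ if there is a linear isometric embedding $U:Y\to\operatorname{Lip}_0(M)$ with $U(Y)\subseteq\operatorname{SNA}(M)$. $c_0$ is the space of real sequences converging to $0$ with the supremum norm. The separation radius of $x\in M$ is $R(x)=\inf\{d(x,y): y\in M\setminus\{x\}\}$; $x$ attains its separation radius if there is $y\in M\setminus\{x\}$ with $R(x)=d(x,y)$. $M$ is uniformly discrete if $\inf\{R(x):x\in M\}>0$. *)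

theory Defs
  imports "HOL-Analysis.Analysis"
begin

text \<open>
  Metric spaces are values of the library type \<open>'a metric\<close>, so that the carrier
  \<open>mspace m\<close> is a set and the distance \<open>mdist m\<close> need not be the canonical
  one of \<open>'a\<close>.  The suprema and infima below are literal; they are meaningful as soon as
  \<open>mspace m\<close> has at least two points.
\<close>

text \<open>
  Functions on the carrier are represented by functions on the whole type that vanish off
  the carrier.  This makes the representation unique and compatible with the pointwise
  vector space operations.
\<close>

definition Lip0 :: "'a metric \<Rightarrow> 'a \<Rightarrow> ('a \<Rightarrow> real) set" where
  "Lip0 m z = {f. Lipschitz_continuous_map m euclidean_metric f \<and> f z = 0 \<and>
                  (\<forall>x. x \<notin> mspace m \<longrightarrow> f x = 0)}"

definition Lip_norm :: "'a metric \<Rightarrow> ('a \<Rightarrow> real) \<Rightarrow> real" where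
  "Lip_norm m f =
     Sup {\<bar>f y - f x\<bar> / mdist m x y | x y. x \<in> mspace m \<and> y \<in> mspace m \<and> x \<noteq> y}"

definition strongly_attains_norm :: "'a metric \<Rightarrow> ('a \<Rightarrow> real) \<Rightarrow> bool" where
  "strongly_attains_norm m f \<longleftrightarrow>
     (\<exists>p\<in>mspace m. \<exists>q\<in>mspace m. p \<noteq> q \<and> Lip_norm m f = \<bar>f p - f q\<bar> / mdist m p q)"

definition SNA :: "'a metric \<Rightarrow> 'a \<Rightarrow> ('a \<Rightarrow> real) set" where
  "SNA m z = {f \<in> Lip0 m z. strongly_attains_norm m f}"

text \<open>
  The space to be embedded is given as a linear subspace \<open>Y\<close> of an ambient normed space.
  Function types carry no \<open>real_vector\<close> structure, so linearity of \<open>U\<close> into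
  \<open>Lip0 m z\<close> is spelled out pointwise.
\<close>

definition linear_isometric_embedding ::
    "'v::real_normed_vector set \<Rightarrow> 'a metric \<Rightarrow> 'a \<Rightarrow> ('v \<Rightarrow> 'a \<Rightarrow> real) \<Rightarrow> bool" where
  "linear_isometric_embedding Y m z U \<longleftrightarrow>
     (\<forall>u\<in>Y. U u \<in> Lip0 m z) \<and>
     (\<forall>u\<in>Y. \<forall>v\<in>Y. U (u + v) = (\<lambda>x. U u x + U v x)) \<and>
     (\<forall>c. \<forall>u\<in>Y. U (c *\<^sub>R u) = (\<lambda>x. c * U u x)) \<and>
     (\<forall>u\<in>Y. Lip_norm m (U u) = norm u)"

definition isometrically_contained_in_SNA ::
    "'v::real_normed_vector set \<Rightarrow> 'a metric \<Rightarrow> 'a \<Rightarrow> bool" where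
  "isometrically_contained_in_SNA Y m z \<longleftrightarrow>
     (\<exists>U. linear_isometric_embedding Y m z U \<and> U ` Y \<subseteq> SNA m z)"

text \<open>
  Since \<open>nat\<close> is discrete, \<open>nat \<Rightarrow>\<^sub>C real\<close> is the space of all bounded real
  sequences with the supremum norm; the null sequences form a subspace of it.
\<close>

definition c0_space :: "(nat \<Rightarrow>\<^sub>C real) set" where
  "c0_space = {s. apply_bcontfun s \<longlonglongrightarrow> 0}"

lemma subspace_c0_space: "subspace c0_space"
proof (rule subspaceI)
  show "0 \<in> c0_space"
    by (simp add: c0_space_def zero_bcontfun.rep_eq)
next
  fix s t assume "s \<in> c0_space" "t \<in> c0_space"
  then show "s + t \<in> c0_space"
    using tendsto_add[of "apply_bcontfun s" 0 sequentially "apply_bcontfun t" 0]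
    by (simp add: c0_space_def plus_bcontfun.rep_eq)
next
  fix c :: real and s assume "s \<in> c0_space"
  then show "c *\<^sub>R s \<in> c0_space"
    using tendsto_mult_right_zero[of "apply_bcontfun s" sequentially c]
    by (simp add: c0_space_def scaleR_bcontfun.rep_eq)
qed

lemma norm_bcontfun_nat_eq_Sup:
  "norm (s :: nat \<Rightarrow>\<^sub>C real) = (SUP n. \<bar>apply_bcontfun s n\<bar>)"
  by (simp add: norm_bcontfun_def dist_bcontfun_def zero_bcontfun.rep_eq)

definition separation_radius :: "'a metric \<Rightarrow> 'a \<Rightarrow> real" where
  "separation_radius m x = Inf {mdist m x y | y. y \<in> mspace m - {x}}"

definition attains_separation_radius :: "'a metric \<Rightarrow> 'a \<Rightarrow> bool" where
  "attains_separation_radius m x \<longleftrightarrow>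
     (\<exists>y \<in> mspace m - {x}. separation_radius m x = mdist m x y)"

definition uniformly_discrete_metric :: "'a metric \<Rightarrow> bool" where
  "uniformly_discrete_metric m \<longleftrightarrow> Inf {separation_radius m x | x. x \<in> mspace m} > 0"

end

theory Submission
  imports Defs
begin

text \<open>
  On \<open>\<nat>\<close> put \<open>d(i,j) = 1 + 1/(2 + max i j)\<close> for \<open>i \<noteq> j\<close>.  Every separation radius is \<open>1\<close>
  and none is attained.  Suppose the images \<open>f\<^sub>n\<close> of the unit vectors of \<open>c\<^sub>0\<close> attain their norms at
  pairs \<open>(p\<^sub>n, q\<^sub>n)\<close>.  Since \<open>\<parallel>f\<^sub>n \<plusminus> f\<^sub>m\<parallel> \<le> 1\<close>, the function \<open>f\<^sub>m\<close> is constant on \<open>{p\<^sub>n, q\<^sub>n}\<close> and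
  vice versa, and adding the Lipschitz estimates for \<open>f\<^sub>n \<plusminus> f\<^sub>m\<close> over the four cross pairs gives
  \<open>2 d(p\<^sub>n,q\<^sub>n) + 2 d(p\<^sub>m,q\<^sub>m) \<le> d(p\<^sub>n,p\<^sub>m) + d(p\<^sub>n,q\<^sub>m) + d(q\<^sub>n,p\<^sub>m) + d(q\<^sub>n,q\<^sub>m)\<close>.  As all distances lie in
  \<open>(1, 4/3]\<close>, this forces the pairs to be disjoint; hence some pair lies entirely beyond
  \<open>{p\<^sub>0, q\<^sub>0}\<close>, and for that pair the inequality fails because distances decrease with the larger index.
\<close>

section \<open>Norming pairs of Lipschitz functions in an arbitrary metric space\<close>

lemma abs_diff_le_Lip_norm:
  assumes f: "Lipschitz_continuous_map m euclidean_metric f"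
    and x: "x \<in> mspace m" and y: "y \<in> mspace m"
  shows "\<bar>f x - f y\<bar> \<le> Lip_norm m f * mdist m x y"
proof (cases "x = y")
  case True
  then have "mdist m x y = 0" using x by (simp add: Metric_space.mdist_zero[OF Metric_space_mspace_mdist])
  with True show ?thesis by simp
next
  case False
  let ?S = "{\<bar>f y - f x\<bar> / mdist m x y | x y. x \<in> mspace m \<and> y \<in> mspace m \<and> x \<noteq> y}"
  obtain B where B: "\<And>x y. \<lbrakk>x \<in> mspace m; y \<in> mspace m\<rbrakk> \<Longrightarrow> \<bar>f x - f y\<bar> \<le> B * mdist m x y"
    using f by (auto simp: Lipschitz_continuous_map_def dist_real_def)
  \<comment> \<open>A Lipschitz constant bounds all difference quotients, so the \<open>Sup\<close>
    in \<open>Lip_norm\<close> is a genuine supremum.\<close>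
  have "bdd_above ?S"
  proof (rule bdd_aboveI)
    fix s assume "s \<in> ?S"
    then obtain u v where uv: "u \<in> mspace m" "v \<in> mspace m" "u \<noteq> v"
      and s: "s = \<bar>f v - f u\<bar> / mdist m u v" by blast
    then have "mdist m u v > 0"
      by (simp add: Metric_space.mdist_pos_eq[OF Metric_space_mspace_mdist])
    with B[OF uv(1,2)] show "s \<le> B"
      by (simp add: s divide_le_eq abs_minus_commute)
  qed
  moreover have "\<bar>f x - f y\<bar> / mdist m x y \<in> ?S"
    using x y False by (force simp: abs_minus_commute)
  ultimately have "\<bar>f x - f y\<bar> / mdist m x y \<le> Lip_norm m f"
    unfolding Lip_norm_def by (rule cSup_upper[rotated])
  moreover have "mdist m x y > 0"
    using x y False by (simp add: Metric_space.mdist_pos_eq[OF Metric_space_mspace_mdist])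
  ultimately show ?thesis by (simp add: divide_le_eq)
qed

text \<open>As \<open>f\<close> uses up the whole of \<open>d p q\<close>, \<open>g\<close> is
  constant on \<open>{p, q}\<close>; likewise \<open>f\<close> is constant on \<open>{r, s}\<close>.
  Over the four cross pairs the increments of \<open>f\<close> go from \<open>p\<close> and from
  \<open>q\<close> to one common value, each twice, so by the triangle inequality they sum to at
  least \<open>2 * d p q\<close>. Those of \<open>g\<close> give \<open>2 * d r s\<close>.\<close>

lemma cross_distances:
  fixes f g :: "'a \<Rightarrow> real"
  assumes plus: "\<And>x y. \<lbrakk>x \<in> S; y \<in> S\<rbrakk> \<Longrightarrow> \<bar>(f x + g x) - (f y + g y)\<bar> \<le> d x y"
    and minus: "\<And>x y. \<lbrakk>x \<in> S; y \<in> S\<rbrakk> \<Longrightarrow> \<bar>(f x - g x) - (f y - g y)\<bar> \<le> d x y"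
    and S: "p \<in> S" "q \<in> S" "r \<in> S" "s \<in> S"
    and f: "\<bar>f p - f q\<bar> = d p q" and g: "\<bar>g r - g s\<bar> = d r s"
  shows "2 * d p q + 2 * d r s \<le> d p r + d p s + d q r + d q s"
proof -
  \<comment> \<open>The larger of \<open>\<bar>a + b\<bar>\<close> and
    \<open>\<bar>a - b\<bar>\<close> is \<open>\<bar>a\<bar> + \<bar>b\<bar>\<close>.\<close>
  have *: "\<bar>f x - f y\<bar> + \<bar>g x - g y\<bar> \<le> d x y" if "x \<in> S" "y \<in> S" for x y
    using plus[OF that] minus[OF that] by linarith
  have "g p = g q" using *[OF S(1,2)] f by linarith
  moreover have "f r = f s" using *[OF S(3,4)] g by linarith
  ultimately show ?thesis
    using *[OF S(1,3)] *[OF S(1,4)] *[OF S(2,3)] *[OF S(2,4)] f g by linarith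
qed

section \<open>Unit vectors of c_0 and their images under an embedding\<close>

definition unit_seq :: "nat \<Rightarrow> nat \<Rightarrow>\<^sub>C real" where
  "unit_seq n = Bcontfun (\<lambda>k. if k = n then 1 else 0)"

lemma apply_unit_seq: "apply_bcontfun (unit_seq n) k = (if k = n then 1 else 0)"
proof -
  have "(\<lambda>k. if k = n then 1 else (0::real)) \<in> bcontfun"
    by (rule bcontfun_normI[where b = 1]) auto
  then show ?thesis by (simp add: unit_seq_def Bcontfun_inverse)
qed

lemma unit_seq_in_c0: "unit_seq n \<in> c0_space"
  unfolding c0_space_def mem_Collect_eq
  by (rule tendsto_eventually, rule eventually_sequentiallyI[of "Suc n"]) (simp add: apply_unit_seq)

lemma norm_unit_seq: "norm (unit_seq n) = 1"
proof (rule antisym)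
  show "norm (unit_seq n) \<le> 1" by (rule norm_bound) (simp add: apply_unit_seq)
  show "1 \<le> norm (unit_seq n)"
    using norm_bounded[of "unit_seq n" n] by (simp add: apply_unit_seq)
qed

lemma norm_unit_seq_add_le: "n \<noteq> k \<Longrightarrow> norm (unit_seq n + unit_seq k) \<le> 1"
  by (rule norm_bound) (simp add: apply_unit_seq plus_bcontfun.rep_eq)

text \<open>The difference is written with \<open>(-1) *\<^sub>R\<close> because an embedding is
  only assumed to respect sums and scalar multiples.\<close>

lemma norm_unit_seq_diff_le: "n \<noteq> k \<Longrightarrow> norm (unit_seq n + (-1) *\<^sub>R unit_seq k) \<le> 1"
  by (rule norm_bound) (simp add: apply_unit_seq plus_bcontfun.rep_eq scaleR_bcontfun.rep_eq)

text \<open>Sums and differences of two distinct unit vectors have norm at most 1, so their images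
  are 1-Lipschitz and \<open>cross_distances\<close> applies to any two of the attaining
  pairs.\<close>

lemma c0_in_SNA_imp_norming_pairs:
  fixes m :: "'a metric"
  assumes "isometrically_contained_in_SNA c0_space m z"
  shows "\<exists>p q :: nat \<Rightarrow> 'a.
    (\<forall>n. p n \<in> mspace m) \<and> (\<forall>n. q n \<in> mspace m) \<and> (\<forall>n. p n \<noteq> q n) \<and>
    (\<forall>n k. n \<noteq> k \<longrightarrow> 2 * mdist m (p n) (q n) + 2 * mdist m (p k) (q k)
       \<le> mdist m (p n) (p k) + mdist m (p n) (q k) + mdist m (q n) (p k) + mdist m (q n) (q k))"
proof -
  obtain U where "linear_isometric_embedding c0_space m z U" and SNA: "U ` c0_space \<subseteq> SNA m z"
    using assms by (auto simp: isometrically_contained_in_SNA_def)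
  then have Lip0: "\<And>u. u \<in> c0_space \<Longrightarrow> U u \<in> Lip0 m z"
    and add: "\<And>u v. \<lbrakk>u \<in> c0_space; v \<in> c0_space\<rbrakk> \<Longrightarrow> U (u + v) = (\<lambda>x. U u x + U v x)"
    and scale: "\<And>c u. u \<in> c0_space \<Longrightarrow> U (c *\<^sub>R u) = (\<lambda>x. c * U u x)"
    and norm: "\<And>u. u \<in> c0_space \<Longrightarrow> Lip_norm m (U u) = norm u"
    by (auto simp: linear_isometric_embedding_def)
  define f where "f n = U (unit_seq n)" for n
  have bound: "\<bar>U u x - U u y\<bar> \<le> mdist m x y"
    if "u \<in> c0_space" "norm u \<le> 1" "x \<in> mspace m" "y \<in> mspace m" for u x y
  proof -
    have "\<bar>U u x - U u y\<bar> \<le> norm u * mdist m x y"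
      using abs_diff_le_Lip_norm[OF _ that(3,4), of "U u"] Lip0[OF that(1)] norm[OF that(1)]
      by (simp add: Lip0_def)
    also have "\<dots> \<le> mdist m x y"
      using that(2) by (simp add: mult_left_le_one_le)
    finally show ?thesis .
  qed
  have "\<forall>n. \<exists>p q. p \<in> mspace m \<and> q \<in> mspace m \<and> p \<noteq> q \<and> \<bar>f n p - f n q\<bar> = mdist m p q"
  proof
    fix n
    have "f n \<in> SNA m z" using SNA unit_seq_in_c0 by (auto simp: f_def)
    then obtain p q where pq: "p \<in> mspace m" "q \<in> mspace m" "p \<noteq> q"
      and "Lip_norm m (f n) = \<bar>f n p - f n q\<bar> / mdist m p q"
      by (auto simp: SNA_def strongly_attains_norm_def)
    moreover have "Lip_norm m (f n) = 1"
      by (simp add: f_def norm unit_seq_in_c0 norm_unit_seq)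
    moreover have "mdist m p q \<noteq> 0" using pq by simp
    ultimately have "\<bar>f n p - f n q\<bar> = mdist m p q" by simp
    with pq show "\<exists>p q. p \<in> mspace m \<and> q \<in> mspace m \<and> p \<noteq> q \<and> \<bar>f n p - f n q\<bar> = mdist m p q"
      by blast
  qed
  then obtain p q where pq: "\<And>n. p n \<in> mspace m" "\<And>n. q n \<in> mspace m" "\<And>n. p n \<noteq> q n"
    and attain: "\<And>n. \<bar>f n (p n) - f n (q n)\<bar> = mdist m (p n) (q n)"
    by metis
  have "2 * mdist m (p n) (q n) + 2 * mdist m (p k) (q k)
      \<le> mdist m (p n) (p k) + mdist m (p n) (q k) + mdist m (q n) (p k) + mdist m (q n) (q k)"
    if nk: "n \<noteq> k" for n k
  proof (rule cross_distances[where S = "mspace m" and f = "f n" and g = "f k"])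
    note sub = subspace_add[OF subspace_c0_space] subspace_scale[OF subspace_c0_space]
    fix x y assume xy: "x \<in> mspace m" "y \<in> mspace m"
    show "\<bar>(f n x + f k x) - (f n y + f k y)\<bar> \<le> mdist m x y"
      using bound[OF _ norm_unit_seq_add_le[OF nk] xy] sub
      by (simp add: unit_seq_in_c0 add f_def)
    have "U (unit_seq n + (-1) *\<^sub>R unit_seq k) = (\<lambda>x. f n x + (-1) * f k x)"
      by (simp only: add scale f_def unit_seq_in_c0 sub)
    then show "\<bar>(f n x - f k x) - (f n y - f k y)\<bar> \<le> mdist m x y"
      using bound[OF sub(1)[OF unit_seq_in_c0 sub(2)[OF unit_seq_in_c0]]
          norm_unit_seq_diff_le[OF nk] xy]
      by simp
  qed (use pq attain in auto)
  with pq show ?thesis by (intro exI[of _ p] exI[of _ q]) simp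
qed

section \<open>The metric space and its separation radii\<close>

definition max_dist :: "real \<Rightarrow> real \<Rightarrow> real" where
  "max_dist x y = (if x = y then 0 else 1 + 1 / (2 + max \<bar>x\<bar> \<bar>y\<bar>))"

lemma max_dist_self [simp]: "max_dist x x = 0"
  by (simp add: max_dist_def)

definition max_metric :: "real metric" where
  "max_metric = metric (\<nat>, max_dist)"

lemma max_dist_bounds:
  assumes "x \<in> \<nat>" "y \<in> \<nat>" "x \<noteq> y"
  shows "1 < max_dist x y" "max_dist x y \<le> 4 / 3"
proof -
  obtain a b where "x = real a" "y = real b" using assms by (auto elim!: Nats_cases)
  \<comment> \<open>Distinct naturals have maximum at least 1, whence the bound
    \<open>1 + 1 / 3\<close>.\<close>
  with assms(3) have "max x y \<ge> 1" by auto
  then show "1 < max_dist x y" "max_dist x y \<le> 4 / 3"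
    using assms(3) by (auto simp: max_dist_def field_simps)
qed

lemma max_dist_le: "\<lbrakk>x \<in> \<nat>; y \<in> \<nat>\<rbrakk> \<Longrightarrow> max_dist x y \<le> 4 / 3"
  using max_dist_bounds(2)[of x y] by (cases "x = y") auto

interpretation max_metric: Metric_space "\<nat>" max_dist
proof
  \<comment> \<open>\<open>Metric_space\<close> asks for symmetry and nonnegativity off the carrier
    too; the absolute values in \<open>max_dist\<close> provide the latter.\<close>
  fix x y :: real
  show "max_dist x y = max_dist y x" by (simp add: max_dist_def max.commute)
  show "0 \<le> max_dist x y" by (simp add: max_dist_def)
next
  fix x y :: real assume "x \<in> \<nat>" "y \<in> \<nat>"
  then show "max_dist x y = 0 \<longleftrightarrow> x = y"
    using max_dist_bounds(1)[of x y] by (cases "x = y") auto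
next
  fix x y z :: real assume "x \<in> \<nat>" "y \<in> \<nat>" "z \<in> \<nat>"
  \<comment> \<open>Two nonzero distances add up to more than 2, which exceeds
    \<open>4 / 3\<close>.\<close>
  then show "max_dist x z \<le> max_dist x y + max_dist y z"
    using max_dist_bounds[of x y] max_dist_bounds[of y z] max_dist_le[of x z]
    by (cases "x = y"; cases "y = z") auto
qed

lemma mspace_max_metric [simp]: "mspace max_metric = \<nat>"
  and mdist_max_metric [simp]: "mdist max_metric = max_dist"
  by (simp_all add: max_metric_def max_metric.mspace_metric max_metric.mdist_metric)

lemma separation_radius_max_metric:
  assumes x: "x \<in> \<nat>"
  shows "separation_radius max_metric x = 1"
  unfolding separation_radius_def mspace_max_metric mdist_max_metric
proof (rule cInf_eq)
  fix r assume "r \<in> {max_dist x y | y. y \<in> \<nat> - {x}}"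
  then show "1 \<le> r" using max_dist_bounds(1)[OF x] by (auto intro: less_imp_le)
next
  fix r assume r: "\<And>s. s \<in> {max_dist x y | y. y \<in> \<nat> - {x}} \<Longrightarrow> r \<le> s"
  show "r \<le> 1"
  proof (rule field_le_epsilon)
    fix e :: real assume e: "0 < e"
    \<comment> \<open>A far point serves as witness: \<open>k > \<bar>x\<bar>\<close> makes
      \<open>k\<close> the maximum, and \<open>k > 1 / e\<close> makes the excess over 1 at most
      \<open>e\<close>.\<close>
    obtain k :: nat where k: "max \<bar>x\<bar> (1 / e) < real k" using reals_Archimedean2 by blast
    then have "real k \<noteq> x" by auto
    then have "r \<le> max_dist x k" by (intro r) auto
    also have "\<dots> = 1 + 1 / (2 + real k)" using k \<open>real k \<noteq> x\<close> by (simp add: max_dist_def)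
    also have "1 / (2 + real k) \<le> 1 / (1 / e)" using k e by (intro divide_left_mono) auto
    finally show "r \<le> 1 + e" by simp
  qed
qed

text \<open>Distinct points are more than 1 apart, so a Cauchy sequence is eventually
  constant.\<close>

lemma mcomplete_max_metric: "mcomplete_of max_metric"
  unfolding mcomplete_of_def mspace_max_metric mdist_max_metric max_metric.mcomplete_def
proof (intro allI impI)
  fix \<sigma> assume "max_metric.MCauchy \<sigma>"
  then have ran: "\<And>n. \<sigma> n \<in> \<nat>"
    and "\<exists>N. \<forall>n n'. N \<le> n \<longrightarrow> N \<le> n' \<longrightarrow> max_dist (\<sigma> n) (\<sigma> n') < 1"
    by (auto simp: max_metric.MCauchy_def)
  then obtain N where N: "\<And>n. N \<le> n \<Longrightarrow> max_dist (\<sigma> N) (\<sigma> n) < 1" by blast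
  have "\<sigma> n = \<sigma> N" if "N \<le> n" for n
    using N[OF that] max_dist_bounds(1)[OF ran ran, of N n] by force
  then have "\<forall>\<^sub>F n in sequentially. \<sigma> n = \<sigma> N" by (rule eventually_sequentiallyI)
  then have "limitin max_metric.mtopology \<sigma> (\<sigma> N) sequentially"
    by (rule limitin_eventually[rotated]) (simp add: ran)
  then show "\<exists>x. limitin max_metric.mtopology \<sigma> x sequentially" ..
qed

section \<open>Norming pairs cannot exist for this metric\<close>

lemma cross_max_dist_less:
  assumes nat: "p \<in> \<nat>" "q \<in> \<nat>" "r \<in> \<nat>" "s \<in> \<nat>" and ne: "p \<noteq> q" "r \<noteq> s"
    and far: "max p q < min r s"
  shows "max_dist p r + max_dist p s + max_dist q r + max_dist q s
    < 2 * max_dist p q + 2 * max_dist r s"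
proof -
  have nonneg: "0 \<le> p" "0 \<le> q" using nat by (auto elim: Nats_cases)
  \<comment> \<open>Apart from the constant 4 on both sides, the cross distances sum to
    \<open>2 / (2 + r) + 2 / (2 + s)\<close>. Once the term of \<open>max r s\<close> cancels, only
    \<open>min r s\<close> is compared with \<open>max p q\<close>.\<close>
  have lt: "1 / (2 + min r s) < 1 / (2 + max p q)"
    using nonneg far by (intro divide_strict_left_mono) auto
  have "1 / (2 + r) + 1 / (2 + s) = 1 / (2 + min r s) + 1 / (2 + max r s)"
    by (simp add: min_def max_def)
  with lt have "2 / (2 + r) + 2 / (2 + s) < 2 / (2 + max p q) + 2 / (2 + max r s)"
    by argo
  moreover have "max_dist x y = 1 + 1 / (2 + y)" if "x \<in> {p, q}" "y \<in> {r, s}" for x y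
  proof -
    have "x < y" "0 \<le> x" using that far nonneg by auto
    then show ?thesis by (simp add: max_dist_def)
  qed
  moreover have "max_dist p q = 1 + 1 / (2 + max p q)" "max_dist r s = 1 + 1 / (2 + max r s)"
    using ne nonneg far by (auto simp: max_dist_def)
  ultimately show ?thesis by simp
qed

lemma no_norming_pairs_max_dist:
  fixes p q :: "nat \<Rightarrow> real"
  assumes nat [rule_format]: "\<forall>n. p n \<in> \<nat>" "\<forall>n. q n \<in> \<nat>"
    and ne [rule_format]: "\<forall>n. p n \<noteq> q n"
    and cross [rule_format]: "\<forall>n k. n \<noteq> k \<longrightarrow> 2 * max_dist (p n) (q n) + 2 * max_dist (p k) (q k)
       \<le> max_dist (p n) (p k) + max_dist (p n) (q k) + max_dist (q n) (p k) + max_dist (q n) (q k)"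
  shows False
proof -
  have disjoint: "{p n, q n} \<inter> {p k, q k} = {}" if "n \<noteq> k" for n k
  proof (rule ccontr)
    \<comment> \<open>A shared point makes one cross distance vanish; the other three total at most
      4, while the left side of \<open>cross\<close> exceeds 4.\<close>
    assume "{p n, q n} \<inter> {p k, q k} \<noteq> {}"
    then have "max_dist (p n) (p k) = 0 \<or> max_dist (p n) (q k) = 0 \<or>
        max_dist (q n) (p k) = 0 \<or> max_dist (q n) (q k) = 0"
      by (auto simp: max_dist_def)
    then show False
      using cross[OF that] max_dist_bounds(1)[OF nat ne, of n] max_dist_bounds(1)[OF nat ne, of k]
        max_dist_le[OF nat(1) nat(1), of n k] max_dist_le[OF nat(1) nat(2), of n k]
        max_dist_le[OF nat(2) nat(1), of n k] max_dist_le[OF nat(2) nat(2), of n k]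
      by linarith
  qed
  \<comment> \<open>Disjoint pairs have distinct minima, and only finitely many naturals are at most
    \<open>max (p 0) (q 0)\<close>, so some pair lies entirely beyond the pair of index 0.\<close>
  have "inj (\<lambda>n. min (p n) (q n))"
  proof (rule injI, rule ccontr)
    fix n k assume "min (p n) (q n) = min (p k) (q k)" "n \<noteq> k"
    with disjoint[of n k] show False by (auto simp: min_def split: if_splits)
  qed
  then have "infinite (range (\<lambda>n. min (p n) (q n)))" by (simp add: finite_image_iff)
  moreover have "finite {x \<in> \<nat>. x \<le> max (p 0) (q 0)}"
  proof (rule finite_subset)
    show "{x \<in> \<nat>. x \<le> max (p 0) (q 0)} \<subseteq> real ` {..nat \<lfloor>max (p 0) (q 0)\<rfloor>}"
      by (auto elim!: Nats_cases intro!: imageI le_nat_floor)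
  qed simp
  ultimately obtain n where "min (p n) (q n) \<notin> {x \<in> \<nat>. x \<le> max (p 0) (q 0)}"
    by (meson finite_subset image_subsetI)
  moreover have "min (p n) (q n) \<in> \<nat>" using nat by (simp add: min_def)
  ultimately have far: "max (p 0) (q 0) < min (p n) (q n)" by auto
  then have "0 \<noteq> n" by (intro notI) simp
  from cross[OF this] cross_max_dist_less[OF nat nat ne ne far] show False by linarith
qed

lemma c0_not_in_SNA_max_metric: "\<not> isometrically_contained_in_SNA c0_space max_metric z"
proof
  assume "isometrically_contained_in_SNA c0_space max_metric z"
  from c0_in_SNA_imp_norming_pairs[OF this] show False
    unfolding mspace_max_metric mdist_max_metric
    by (elim exE conjE) (rule no_norming_pairs_max_dist)
qed

theorem theorem4p1:
  shows "\<exists>(m :: real metric) z.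
    z \<in> mspace m \<and>
    infinite (mspace m) \<and>
    Metric_space.mbounded (mspace m) (mdist m) (mspace m) \<and>
    uniformly_discrete_metric m \<and>
    mcomplete_of m \<and>
    \<not> isometrically_contained_in_SNA c0_space m z \<and>
    (\<forall>x \<in> mspace m. \<not> attains_separation_radius m x)"
proof (intro exI[of _ max_metric] exI[of _ 0] conjI ballI)
  show "0 \<in> mspace max_metric" by simp
  show "infinite (mspace max_metric)"
    by (simp add: Nats_def finite_image_iff inj_of_nat)
  have "\<nat> \<subseteq> max_metric.mcball 0 (4 / 3)"
    using max_dist_le[OF Nats_0] by (intro subsetI) (simp only: max_metric.in_mcball Nats_0)
  then show "Metric_space.mbounded (mspace max_metric) (mdist max_metric) (mspace max_metric)"
    by (auto simp: max_metric.mbounded_def)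
  have "{separation_radius max_metric x | x. x \<in> mspace max_metric} = {1}"
    by (auto simp: separation_radius_max_metric intro: exI[of _ 0])
  then show "uniformly_discrete_metric max_metric"
    by (simp add: uniformly_discrete_metric_def)
  show "mcomplete_of max_metric" by (rule mcomplete_max_metric)
  show "\<not> isometrically_contained_in_SNA c0_space max_metric 0"
    by (rule c0_not_in_SNA_max_metric)
  fix x assume "x \<in> mspace max_metric"
  then show "\<not> attains_separation_radius max_metric x"
    \<comment> \<open>Attainment would need a point at distance exactly 1, but the lower bound is
      strict.\<close>
    using max_dist_bounds(1)[of x]
    by (force simp: attains_separation_radius_def separation_radius_max_metric)
qed

end
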